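(* Consider the piecewise linear system $$ \left\{\begin{array}{l}\dot x=T_Lx-y\\ \dot y=D_Lx-a_L\end{array}\right.\ \text{for } x<0,\qquad \left\{\begin{array}{l}\dot x=T_Rx-y+b\\ \dot y=D_Rx-a_R\end{array}\right.\ \text{for } x>0, $$ with $T_L,D_L,a_L,T_R,D_R,a_R,b\in\mathbb{R}$, $a_L^2+D_L^2\neq0$ and $a_R^2+D_R^2\neq0$. Assume that $T_LT_R\geqslant0$ and that one of the following two non-exclusive hypotheses holds: 1) $T_L\neq0$ and $T_Lb\geqslant0$; 2) $T_R\neq0$ and $T_Rb\geqslant0$. Then the system does not have crossing periodic orbits.
   Context: Let $\Sigma=\{(x,y)\in\mathbb{R}^2:x=0\}$. A crossing periodic orbit of the piecewise linear system is a closed orbit formed by an arc of the left system contained in $x<0$ going from $(0,y_0)$ to $(0,y_1)$ and an arc of the right system contained in $x>0$ going from $(0,y_1)$ to $(0,y_0)$, where $y_0>\max\{0,b\}$ and $y_1<\min\{0,b\}$ (both vector fields cross $\Sigma$ transversally in the same direction at these points). *)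

theory Defs
  imports "HOL-Analysis.Analysis"
begin

definition left_field :: "real \<Rightarrow> real \<Rightarrow> real \<Rightarrow> real \<times> real \<Rightarrow> real \<times> real" where
  "left_field T D a = (\<lambda>(x, y). (T * x - y, D * x - a))"

definition right_field :: "real \<Rightarrow> real \<Rightarrow> real \<Rightarrow> real \<Rightarrow> real \<times> real \<Rightarrow> real \<times> real" where
  "right_field T D a b = (\<lambda>(x, y). (T * x - y + b, D * x - a))"

(* A is the trace of a solution of the autonomous equation p' = X p that starts at p, runs inside
   the open region S and ends at q.  The endpoints may lie on the boundary of S, so the equation
   is imposed at interior times only and the solution is continuous up to the endpoints. *)
definition orbit_arc ::
  "(real \<times> real \<Rightarrow> real \<times> real) \<Rightarrow> (real \<times> real) set \<Rightarrow> real \<times> real \<Rightarrow> real \<times> real \<Rightarrow>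
    (real \<times> real) set \<Rightarrow> bool" where
  "orbit_arc X S p q A \<longleftrightarrow>
    (\<exists>\<tau> \<gamma>. \<tau> > 0 \<and> continuous_on {0..\<tau>} \<gamma> \<and> \<gamma> 0 = p \<and> \<gamma> \<tau> = q \<and>
      (\<forall>t\<in>{0<..<\<tau>}. \<gamma> t \<in> S \<and> (\<gamma> has_vector_derivative X (\<gamma> t)) (at t)) \<and>
      A = \<gamma> ` {0..\<tau>})"

(* On the line x = 0 the first components of the two fields are - y and b - y: the bounds on y0
   and y1 say that both are negative at (0, y0) and both are positive at (0, y1). *)
definition crossing_periodic_orbit ::
  "real \<Rightarrow> real \<Rightarrow> real \<Rightarrow> real \<Rightarrow> real \<Rightarrow> real \<Rightarrow> real \<Rightarrow> (real \<times> real) set \<Rightarrow> bool" where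
  "crossing_periodic_orbit TL DL aL TR DR aR b \<Gamma> \<longleftrightarrow>
    (\<exists>y0 y1 A B. y0 > max 0 b \<and> y1 < min 0 b \<and>
      orbit_arc (left_field TL DL aL) {(x, y). x < 0} (0, y0) (0, y1) A \<and>
      orbit_arc (right_field TR DR aR b) {(x, y). x > 0} (0, y1) (0, y0) B \<and>
      \<Gamma> = A \<union> B)"

end

theory Submission
  imports Defs
begin

text \<open>
  Write p for the first component of the field along a solution. Then
  p^2 + D x^2 - 2 a x has derivative 2 T p^2, and on x = 0 it reduces to p^2.
  Integrating over both arcs of a crossing periodic orbit and adding gives
  TL JL + TR JR + 2 b (y0 - y1) = 0, where JL, JR > 0 are the integrals of 2 p^2. The
  hypotheses say that TL, TR, b do not have opposite signs and that TL, TR are not both 0,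
  so the left-hand side cannot vanish.
\<close>

text \<open>Lets one energy identity serve both arcs, the left one with
  \<open>b = 0\<close>.\<close>

lemma left_field_eq_right_field: "left_field T D a = right_field T D a 0"
  by (simp add: left_field_def right_field_def)

lemma orbit_arc_energy:
  assumes "orbit_arc (right_field T D a b) S (0, u) (0, v) A" and "u \<noteq> b"
  shows "\<exists>J>0. (v - b)\<^sup>2 - (u - b)\<^sup>2 = T * J"
proof -
  obtain \<tau> \<gamma> where \<tau>: "\<tau> > 0" and cont: "continuous_on {0..\<tau>} \<gamma>"
    and ends: "\<gamma> 0 = (0, u)" "\<gamma> \<tau> = (0, v)"
    and deriv: "\<And>t. t \<in> {0<..<\<tau>} \<Longrightarrow>
      (\<gamma> has_vector_derivative right_field T D a b (\<gamma> t)) (at t)"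
    using assms(1) unfolding orbit_arc_def by blast
  define x where "x t = fst (\<gamma> t)" for t
  define y where "y t = snd (\<gamma> t)" for t
  define p where "p t = T * x t - y t + b" for t
  \<comment> \<open>Since x' = p, the first component solves x'' - T x' + D x = a; \<open>E\<close>
    is twice the energy of this oscillator, and only the damping term T x' changes it.\<close>
  define E where "E t = (p t)\<^sup>2 + D * (x t)\<^sup>2 - 2 * a * x t" for t
  define J where "J = integral {0..\<tau>} (\<lambda>t. 2 * (p t)\<^sup>2)"
  have cont_xy: "continuous_on {0..\<tau>} x" "continuous_on {0..\<tau>} y"
    unfolding x_def y_def using cont by (auto intro!: continuous_intros)
  have cont_p: "continuous_on {0..\<tau>} (\<lambda>t. 2 * (p t)\<^sup>2)"
    unfolding p_def using cont_xy by (auto intro!: continuous_intros)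
  have J: "((\<lambda>t. 2 * (p t)\<^sup>2) has_integral J) {0..\<tau>}"
    unfolding J_def using cont_p by (intro integrable_integral integrable_continuous_interval)
  \<comment> \<open>The differential equation is known at interior times only; continuity of
    \<open>E\<close> carries the integration up to the endpoints.\<close>
  have "((\<lambda>t. T * (2 * (p t)\<^sup>2)) has_integral (E \<tau> - E 0)) {0..\<tau>}"
  proof (rule fundamental_theorem_of_calculus_interior)
    show "continuous_on {0..\<tau>} E"
      unfolding E_def p_def using cont_xy by (auto intro!: continuous_intros)
    fix t assume t: "t \<in> {0<..<\<tau>}"
    have field: "right_field T D a b (\<gamma> t) = (p t, D * x t - a)"
      by (simp add: right_field_def p_def x_def y_def split: prod.split)
    have [derivative_intros]: "(x has_real_derivative p t) (at t)"
      "(y has_real_derivative D * x t - a) (at t)"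
      using bounded_linear.has_vector_derivative[OF bounded_linear_fst deriv[OF t]]
        bounded_linear.has_vector_derivative[OF bounded_linear_snd deriv[OF t]]
      by (simp_all add: field x_def[abs_def] y_def[abs_def] has_real_derivative_iff_has_vector_derivative)
    have [derivative_intros]: "(p has_real_derivative T * p t - (D * x t - a)) (at t)"
      unfolding p_def[abs_def] by (auto intro!: derivative_eq_intros simp: p_def)
    have "(E has_real_derivative T * (2 * (p t)\<^sup>2)) (at t)"
      unfolding E_def[abs_def]
      by (auto intro!: derivative_eq_intros simp: algebra_simps power2_eq_square)
    then show "(E has_vector_derivative T * (2 * (p t)\<^sup>2)) (at t)"
      by (simp add: has_real_derivative_iff_has_vector_derivative)
  qed (use \<tau> in simp)
  with has_integral_mult_right[OF J, of T] have "E \<tau> - E 0 = T * J"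
    using has_integral_unique by blast
  moreover have "E \<tau> - E 0 = (v - b)\<^sup>2 - (u - b)\<^sup>2"
    by (simp add: E_def p_def x_def y_def ends power2_eq_square algebra_simps)
  moreover have "J > 0"
  proof -
    \<comment> \<open>A continuous nonnegative integrand with integral 0 vanishes everywhere, but at
      time 0 it is 2 (b - u)^2.\<close>
    have "J \<noteq> 0"
    proof
      assume "J = 0"
      then have "2 * (p 0)\<^sup>2 = 0"
        using has_integral_0_cbox_imp_0[of 0 \<tau> "\<lambda>t. 2 * (p t)\<^sup>2" 0] cont_p J \<tau>
        by simp
      with \<open>u \<noteq> b\<close> show False
        by (simp add: p_def x_def y_def ends)
    qed
    moreover have "J \<ge> 0"
      using J by (rule has_integral_nonneg) simp
    ultimately show ?thesis by simp
  qed
  ultimately show ?thesis by auto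
qed

theorem corollary3:
  fixes TL DL aL TR DR aR b :: real
  assumes "aL\<^sup>2 + DL\<^sup>2 \<noteq> 0"
    and "aR\<^sup>2 + DR\<^sup>2 \<noteq> 0"
    and "TL * TR \<ge> 0"
    and "(TL \<noteq> 0 \<and> TL * b \<ge> 0) \<or> (TR \<noteq> 0 \<and> TR * b \<ge> 0)"
  shows "\<not> (\<exists>\<Gamma>. crossing_periodic_orbit TL DL aL TR DR aR b \<Gamma>)"
proof
  assume "\<exists>\<Gamma>. crossing_periodic_orbit TL DL aL TR DR aR b \<Gamma>"
  then obtain y0 y1 A B where y: "y0 > max 0 b" "y1 < min 0 b"
    and left: "orbit_arc (right_field TL DL aL 0) {(x, y). x < 0} (0, y0) (0, y1) A"
    and right: "orbit_arc (right_field TR DR aR b) {(x, y). x > 0} (0, y1) (0, y0) B"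
    unfolding crossing_periodic_orbit_def left_field_eq_right_field by blast
  \<comment> \<open>Each arc starts where its field crosses the line transversally: y0 > 0 on the
    left, y1 < b on the right.\<close>
  obtain JL where JL: "JL > 0" "y1\<^sup>2 - y0\<^sup>2 = TL * JL"
    using orbit_arc_energy[OF left] y by auto
  obtain JR where JR: "JR > 0" "(y0 - b)\<^sup>2 - (y1 - b)\<^sup>2 = TR * JR"
    using orbit_arc_energy[OF right] y by auto
  define h where "h = 2 * (y0 - y1)"
  have h: "h > 0"
    using y by (simp add: h_def)
  \<comment> \<open>In the sum of the two energy changes all squares cancel, leaving -2 b (y0 -
    y1).\<close>
  have sum_0: "TL * JL + TR * JR + b * h = 0"
    unfolding JL(2)[symmetric] JR(2)[symmetric] h_def
    by (simp add: power2_eq_square algebra_simps)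
  \<comment> \<open>The nonzero trace in the hypothesis fixes the sign: its products with the other
    trace and with \<open>b\<close> are nonnegative.\<close>
  consider "TL \<ge> 0" "TR \<ge> 0" "b \<ge> 0" "TL > 0 \<or> TR > 0"
    | "TL \<le> 0" "TR \<le> 0" "b \<le> 0" "TL < 0 \<or> TR < 0"
    using assms(3,4) by (auto simp: zero_le_mult_iff)
  then show False
  proof cases
    case 1
    then have "TL * JL \<ge> 0" "TR * JR \<ge> 0" "b * h \<ge> 0" "TL * JL > 0 \<or> TR * JR > 0"
      using JL(1) JR(1) h by auto
    with sum_0 show False by linarith
  next
    case 2
    then have "TL * JL \<le> 0" "TR * JR \<le> 0" "b * h \<le> 0" "TL * JL < 0 \<or> TR * JR < 0"
      using JL(1) JR(1) h by (auto simp: mult_le_0_iff mult_less_0_iff)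
    with sum_0 show False by linarith
  qed
qed

end
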